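(* Let $C=[-1,1]$ and let $\eta>0$, $\rho>0$ be fixed constants. For any $(\alpha,\beta)\in\mathbb{R}\times\mathbb{R}$ and any $x^0\in[-1,1]$, the unique solution $x(t)$ of $$\dot{x}(t)=\frac{1}{\eta}\left[P_C\left(x(t)-\frac{1}{\rho}\big(\alpha x(t)+\beta\big)\right)-x(t)\right]\quad\text{for all } t>0,\qquad x(0)=x^0,$$ converges, as $t\to\infty$, to a KKT point of the problem $$\min\Big\{\tfrac{1}{2}\alpha x^2+\beta x \;\Big|\; x\in C\Big\},$$ if either $\alpha\le 0$, or $\alpha>0$ and $\rho\ge\alpha$.
   Context: $P_C$ denotes the metric projection of $\mathbb{R}$ onto $C=[-1,1]$. A point $\bar{x}\in C$ is a Karush-Kuhn-Tucker (KKT) point of $\min\{\tfrac{1}{2}\alpha x^2+\beta x\mid x\in C\}$ if $(\alpha\bar{x}+\beta)(y-\bar{x})\ge 0$ for all $y\in C$. The solution $x(\cdot)$ is the unique $C^1$ solution on $[0,\infty)$ of the stated initial value problem. *)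

theory Defs
  imports "HOL-Analysis.Analysis"
begin

definition C :: "real set" where
  "C = {-1..1}"

text \<open>\<open>C\<close> is nonempty, compact and convex, so \<^const>\<open>closest_point\<close> \<open>C\<close> is its metric projection.\<close>

definition P_C :: "real \<Rightarrow> real" where
  "P_C = closest_point C"

definition is_KKT_point :: "real \<Rightarrow> real \<Rightarrow> real \<Rightarrow> bool" where
  "is_KKT_point \<alpha> \<beta> xbar \<longleftrightarrow>
     xbar \<in> C \<and> (\<forall>y\<in>C. (\<alpha> * xbar + \<beta>) * (y - xbar) \<ge> 0)"

text \<open>Continuously differentiable on \<open>[0, \<infinity>)\<close>, with the one-sided derivative at \<open>0\<close>;
  \<^const>\<open>C1_differentiable_on\<close> would require a two-sided derivative there.\<close>

definition C1_on_nonneg :: "(real \<Rightarrow> real) \<Rightarrow> bool" where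
  "C1_on_nonneg x \<longleftrightarrow>
     (\<exists>x'. continuous_on {0..} x' \<and>
           (\<forall>t\<ge>0. (x has_real_derivative x' t) (at t within {0..})))"

text \<open>Only the values of \<open>x\<close> on \<open>[0, \<infinity>)\<close> matter.\<close>

definition is_solution ::
    "real \<Rightarrow> real \<Rightarrow> real \<Rightarrow> real \<Rightarrow> real \<Rightarrow> (real \<Rightarrow> real) \<Rightarrow> bool" where
  "is_solution \<eta> \<rho> \<alpha> \<beta> x0 x \<longleftrightarrow>
     C1_on_nonneg x \<and>
     (\<forall>t>0. (x has_real_derivative
               (1 / \<eta>) * (P_C (x t - (1 / \<rho>) * (\<alpha> * x t + \<beta>)) - x t)) (at t)) \<and>
     x 0 = x0"

end

theory Submission imports Defs begin

text \<open>
  The right-hand side is a globally Lipschitz function \<open>F\<close> of \<open>x\<close>, so existence follows from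
  Banach's fixed point theorem in an exponentially weighted sup norm and uniqueness from a Gronwall
  estimate.  The equation is scalar and autonomous: a trajectory starting at a point that is not an
  equilibrium can never hit one, so it is monotone; as \<open>F (- 1) \<ge> 0 \<ge> F 1\<close>, it is bounded by an
  equilibrium in \<open>C\<close>, hence it converges, and its limit is an equilibrium.  By the
  variational characterisation of the projection, the equilibria are exactly the KKT points.
\<close>

section \<open>Scalar autonomous Lipschitz equations\<close>

lemma integral_has_real_derivative_within_atLeast:
  fixes h :: "real \<Rightarrow> real"
  assumes "continuous_on {a..} h" and "a \<le> t"
  shows "((\<lambda>u. integral {a..u} h) has_real_derivative h t) (at t within {a..})"
proof -
  \<comment> \<open>The right end lies beyond \<open>t\<close>, so near \<open>t\<close> the compact
    interval and the half-line agree, even at \<open>t = a\<close>.\<close>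
  have "((\<lambda>u. integral {a..u} h) has_real_derivative h t) (at t within {a..t+1})"
    by (rule integral_has_real_derivative)
       (use assms in \<open>auto intro: continuous_on_subset\<close>)
  moreover have "at t within {a..t+1} = at t within {a..}"
    by (rule at_within_nhd[where S = "{..<t+1}"]) auto
  ultimately show ?thesis by simp
qed

text \<open>Integrating an exponential of rate \<open>K\<close> gains a factor \<open>1 / K\<close>;
  this gain later makes the integral operator a contraction.\<close>

lemma abs_integral_le_exp:
  fixes h :: "real \<Rightarrow> real"
  assumes "continuous_on {0..t} h" and "K > 0" and "M \<ge> 0" and "t \<ge> 0"
    and bound: "\<And>s. 0 \<le> s \<Longrightarrow> s \<le> t \<Longrightarrow> \<bar>h s\<bar> \<le> M * exp (K * s)"
  shows "\<bar>integral {0..t} h\<bar> \<le> M / K * exp (K * t)"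
proof -
  have int: "((\<lambda>s. M * exp (K * s)) has_integral M / K * exp (K * t) - M / K * exp (K * 0)) {0..t}"
    by (rule fundamental_theorem_of_calculus)
       (use assms in \<open>auto intro!: derivative_eq_intros
          simp flip: has_real_derivative_iff_has_vector_derivative\<close>)
  have "norm (integral {0..t} h) \<le> integral {0..t} (\<lambda>s. M * exp (K * s))"
    by (rule integral_norm_bound_integral)
       (use assms int in \<open>auto intro: integrable_continuous_real\<close>)
  also have "\<dots> = M / K * exp (K * t) - M / K * exp (K * 0)"
    using int by (rule integral_unique)
  also have "\<dots> \<le> M / K * exp (K * t)"
    using assms by simp
  finally show ?thesis by simp
qed

text \<open>The unknown is the rescaled curve \<open>y t = exp (- K * t) * x t\<close>. For it the
  weighted norm becomes the ordinary sup norm on bounded continuous functions, so one fixed point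
  yields a solution on the whole half-line without continuation.\<close>

lemma lipschitz_ode_exists:
  fixes F :: "real \<Rightarrow> real"
  assumes lip: "L-lipschitz_on UNIV F"
  shows "\<exists>x. x 0 = x0 \<and> (\<forall>t\<ge>0. (x has_real_derivative F (x t)) (at t within {0..}))"
proof -
  \<comment> \<open>This \<open>K\<close> is positive even if \<open>L = 0\<close>, and it gives
    \<open>L / K \<le> 1 / 2\<close>, the contraction factor.\<close>
  define K where "K = 2 * L + 1"
  have L: "L \<ge> 0" and F: "\<bar>F u - F v\<bar> \<le> L * \<bar>u - v\<bar>" for u v
    using lip lipschitz_on_nonneg lipschitz_onD[OF lip] by (auto simp: dist_real_def)
  have K: "K > 0" "L / K \<le> 1 / 2"
    using L by (auto simp: K_def field_simps)
  have contF: "continuous_on S F" for S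
    using lipschitz_on_continuous_on[OF lip] continuous_on_subset by blast
  define I where "I y t = integral {0..t} (\<lambda>s. F (exp (K * s) * y s))" for y t
  have contH: "continuous_on S (\<lambda>s. F (exp (K * s) * apply_bcontfun y s))" for S y
    by (rule continuous_on_compose2[OF contF]) (auto intro!: continuous_intros)
  have derI: "((I y) has_real_derivative F (exp (K * t) * y t)) (at t within {0..})"
    if "t \<ge> 0" for y :: "real \<Rightarrow>\<^sub>C real" and t
    unfolding I_def using integral_has_real_derivative_within_atLeast[OF contH that] .
  have contI: "continuous_on {0..} (I y)" for y :: "real \<Rightarrow>\<^sub>C real"
    by (rule DERIV_continuous_on) (use derI in auto)
  \<comment> \<open>Bounded continuous functions live on all of the real line;
    \<open>max 0 t\<close> extends the rescaled Picard iterate to negative times by its value at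
    0.\<close>
  define T0 where "T0 y t = exp (- K * max 0 t) * (x0 + I y (max 0 t))" for y t
  have T0: "T0 y \<in> bcontfun" for y :: "real \<Rightarrow>\<^sub>C real"
  proof (rule bcontfun_normI)
    show "continuous_on UNIV (T0 y)"
      unfolding T0_def
      by (intro continuous_intros continuous_on_compose2[OF contI]) auto
    fix t :: real
    define s where "s = max 0 t"
    have s: "s \<ge> 0" by (simp add: s_def)
    \<comment> \<open>Linear growth of \<open>F\<close> gives this constant, with
      \<open>\<bar>F 0\<bar>\<close> absorbed through \<open>1 \<le> exp (K * r)\<close>.\<close>
    define M where "M = \<bar>F 0\<bar> + L * norm y"
    have "M \<ge> 0" using L by (simp add: M_def)
    have "\<bar>F (exp (K * r) * y r)\<bar> \<le> M * exp (K * r)" if "0 \<le> r" for r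
    proof -
      have "1 \<le> exp (K * r)" using K that by simp
      have "\<bar>F (exp (K * r) * y r)\<bar> \<le> \<bar>F 0\<bar> + L * \<bar>exp (K * r) * y r\<bar>"
        using F[of "exp (K * r) * y r" 0] by simp
      also have "\<dots> \<le> \<bar>F 0\<bar> * exp (K * r) + L * (exp (K * r) * norm y)"
        using \<open>1 \<le> exp (K * r)\<close> norm_bounded[of y r] L
        by (intro add_mono mult_left_mono) (auto simp: abs_mult mult_le_cancel_left1)
      finally show ?thesis by (simp add: M_def algebra_simps)
    qed
    then have "\<bar>I y s\<bar> \<le> M / K * exp (K * s)"
      unfolding I_def using abs_integral_le_exp[OF contH K(1) \<open>M \<ge> 0\<close> s] by blast
    then have "exp (- K * s) * \<bar>x0 + I y s\<bar> \<le> exp (- K * s) * (\<bar>x0\<bar> + M / K * exp (K * s))"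
      by (intro mult_left_mono) auto
    also have "\<dots> = exp (- K * s) * \<bar>x0\<bar> + M / K"
      by (simp add: algebra_simps flip: exp_add)
    also have "\<dots> \<le> \<bar>x0\<bar> + M / K"
      using K s by (simp add: mult_left_le_one_le)
    finally show "norm (T0 y t) \<le> \<bar>x0\<bar> + M / K"
      by (simp add: T0_def s_def abs_mult)
  qed
  define T where "T y = Bcontfun (T0 (apply_bcontfun y))" for y
  have T: "apply_bcontfun (T y) = T0 y" for y
    using T0 by (simp add: T_def Bcontfun_inverse)
  have "dist (T y) (T z) \<le> 1 / 2 * dist y z" for y z
  proof (rule dist_bound)
    fix t :: real
    define s where "s = max 0 t"
    have s: "s \<ge> 0" by (simp add: s_def)
    have "\<bar>F (exp (K * r) * y r) - F (exp (K * r) * z r)\<bar> \<le> L * dist y z * exp (K * r)" for r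
    proof -
      have "\<bar>F (exp (K * r) * y r) - F (exp (K * r) * z r)\<bar>
          \<le> L * (exp (K * r) * dist (y r) (z r))"
        using F[of "exp (K * r) * y r" "exp (K * r) * z r"]
        by (simp add: dist_real_def abs_mult flip: right_diff_distrib)
      also have "\<dots> \<le> L * (exp (K * r) * dist y z)"
        using L dist_bounded by (intro mult_left_mono) auto
      finally show ?thesis by (simp add: algebra_simps)
    qed
    moreover have "I y s - I z s
        = integral {0..s} (\<lambda>r. F (exp (K * r) * y r) - F (exp (K * r) * z r))"
      unfolding I_def
      by (rule integral_diff[symmetric]; rule integrable_continuous_real; rule contH)
    ultimately have "\<bar>I y s - I z s\<bar> \<le> L * dist y z / K * exp (K * s)"
      using abs_integral_le_exp[OF continuous_on_diff[OF contH contH] K(1), of "L * dist y z" s y z]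
        L s by simp
    \<comment> \<open>The weight cancels the exponential growth of the integral and leaves the
      factor \<open>L / K\<close>.\<close>
    then have "exp (- K * s) * \<bar>I y s - I z s\<bar>
        \<le> exp (- K * s) * (L * dist y z / K * exp (K * s))"
      by (intro mult_left_mono) auto
    also have "\<dots> = L / K * dist y z"
      by (simp add: exp_minus field_simps)
    also have "\<dots> \<le> 1 / 2 * dist y z"
      using K by (intro mult_right_mono) auto
    finally show "dist (T y t) (T z t) \<le> 1 / 2 * dist y z"
      by (simp add: T T0_def s_def dist_real_def abs_mult flip: right_diff_distrib)
  qed
  then obtain y where "T y = y"
    using banach_fix_type[of "1/2" T] by auto
  then have y: "y t = exp (- K * t) * (x0 + I y t)" if "t \<ge> 0" for t
    using T[of y] that by (simp add: T0_def fun_eq_iff)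
  \<comment> \<open>Undoing the rescaling turns the fixed point equation into the integral form of
    the differential equation.\<close>
  define x where "x t = x0 + I y t" for t
  have x: "exp (K * t) * y t = x t" if "t \<ge> 0" for t
    using y[OF that] by (simp add: x_def exp_minus)
  have "x 0 = x0" by (simp add: x_def I_def)
  moreover have "(x has_real_derivative F (x t)) (at t within {0..})" if "t \<ge> 0" for t
    using derI[OF that, of y] x[OF that] unfolding x_def by (auto intro!: derivative_eq_intros)
  ultimately show ?thesis by blast
qed

section \<open>Uniqueness forward and backward in time\<close>

text \<open>Gronwall's argument for the squared difference. The common value may be at any
  \<open>c\<close> in the interval: forward in time this gives uniqueness for the initial value
  problem, backward in time it prevents a trajectory from reaching an equilibrium.\<close>

lemma lipschitz_ode_unique:
  fixes F y z :: "real \<Rightarrow> real"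
  assumes lip: "L-lipschitz_on UNIV F"
    and y: "continuous_on {a..b} y"
      "\<And>t. a < t \<Longrightarrow> t < b \<Longrightarrow> (y has_real_derivative F (y t)) (at t)"
    and z: "continuous_on {a..b} z"
      "\<And>t. a < t \<Longrightarrow> t < b \<Longrightarrow> (z has_real_derivative F (z t)) (at t)"
    and c: "c \<in> {a..b}" "y c = z c" and t: "t \<in> {a..b}"
  shows "y t = z t"
proof -
  \<comment> \<open>Squared distance with an integrating factor; \<open>k\<close> is chosen below so
    that its term dominates the one coming from \<open>F\<close>.\<close>
  define w where "w k s = (y s - z s)\<^sup>2 * exp (k * s)" for k s
  define w' where "w' k s = (2 * (y s - z s) * (F (y s) - F (z s)) + k * (y s - z s)\<^sup>2) * exp (k * s)"
    for k s
  have cont: "continuous_on {r..s} (w k)" if "a \<le> r" "s \<le> b" for k r s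
    unfolding w_def using that
    by (intro continuous_intros continuous_on_subset[OF y(1)] continuous_on_subset[OF z(1)]) auto
  have der: "(w k has_real_derivative w' k s) (at s)" if "a < s" "s < b" for k s
    unfolding w_def w'_def using y(2)[OF that] z(2)[OF that]
    by (auto intro!: derivative_eq_intros simp: algebra_simps power2_eq_square)
  have bound: "\<bar>2 * (y s - z s) * (F (y s) - F (z s))\<bar> \<le> 2 * L * (y s - z s)\<^sup>2" for s
  proof -
    have "\<bar>F (y s) - F (z s)\<bar> \<le> L * \<bar>y s - z s\<bar>"
      using lipschitz_onD[OF lip] by (auto simp: dist_real_def)
    then have "2 * \<bar>y s - z s\<bar> * \<bar>F (y s) - F (z s)\<bar> \<le> 2 * \<bar>y s - z s\<bar> * (L * \<bar>y s - z s\<bar>)"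
      by (intro mult_left_mono) auto
    also have "\<dots> = 2 * L * \<bar>y s - z s\<bar>\<^sup>2"
      by (simp only: power2_eq_square mult.assoc mult.left_commute)
    also have "2 * \<bar>y s - z s\<bar> * \<bar>F (y s) - F (z s)\<bar> = \<bar>2 * (y s - z s) * (F (y s) - F (z s))\<bar>"
      by (simp only: abs_mult abs_numeral)
    finally show ?thesis by simp
  qed
  consider "c \<le> t" | "t \<le> c" by linarith
  then show ?thesis
  proof cases
    case 1
    \<comment> \<open>Forward in time, \<open>k = - 2 * L\<close> makes \<open>w\<close>
      nonincreasing from its value 0 at \<open>c\<close>.\<close>
    have "w (- 2 * L) t \<le> w (- 2 * L) c"
    proof (rule DERIV_nonpos_imp_decreasing_open[OF 1])
      fix s assume "c < s" "s < t"
      then have "(w (- 2 * L) has_real_derivative w' (- 2 * L) s) (at s)"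
        using c t by (intro der) auto
      moreover have "w' (- 2 * L) s \<le> 0"
        unfolding w'_def using bound[of s] by (intro mult_nonpos_nonneg) auto
      ultimately show "\<exists>d. (w (- 2 * L) has_real_derivative d) (at s) \<and> d \<le> 0" by blast
    qed (use c t in \<open>auto intro: cont\<close>)
    with c show ?thesis by (simp add: w_def mult_le_0_iff)
  next
    case 2
    \<comment> \<open>Backward in time the opposite sign makes \<open>w\<close> nondecreasing up to
      its value 0 at \<open>c\<close>.\<close>
    have "w (2 * L) t \<le> w (2 * L) c"
    proof (rule DERIV_nonneg_imp_increasing_open[OF 2])
      fix s assume "t < s" "s < c"
      then have "(w (2 * L) has_real_derivative w' (2 * L) s) (at s)"
        using c t by (intro der) auto
      moreover have "w' (2 * L) s \<ge> 0"
        unfolding w'_def using bound[of s] by (intro mult_nonneg_nonneg) auto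
      ultimately show "\<exists>d. (w (2 * L) has_real_derivative d) (at s) \<and> d \<ge> 0" by blast
    qed (use c t in \<open>auto intro: cont\<close>)
    with c show ?thesis by (simp add: w_def mult_le_0_iff)
  qed
qed

section \<open>Convergence of bounded trajectories\<close>

text \<open>The speed \<open>F (x t)\<close> can neither vanish, by uniqueness, nor change sign, by
  the intermediate value theorem. So \<open>x\<close> increases below a zero of \<open>F\<close>,
  and a positive speed at the limit would carry it past that limit.\<close>

lemma lipschitz_ode_limit_increasing:
  fixes F x :: "real \<Rightarrow> real"
  assumes lip: "L-lipschitz_on UNIV F"
    and cont: "continuous_on {0..} x"
    and der: "\<And>t. t > 0 \<Longrightarrow> (x has_real_derivative F (x t)) (at t)"
    and pos: "F (x 0) > 0" and b: "x 0 \<le> b" "F b \<le> 0"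
  shows "\<exists>l\<in>{x 0..b}. F l = 0 \<and> (x \<longlongrightarrow> l) at_top"
proof -
  have contF: "continuous_on S F" for S
    using lipschitz_on_continuous_on[OF lip] continuous_on_subset by blast
  have cont': "continuous_on {s..t} x" if "0 \<le> s" for s t
    using that by (auto intro: continuous_on_subset[OF cont])
  have nz: "F (x t) \<noteq> 0" if "t \<ge> 0" for t
  proof
    assume "F (x t) = 0"
    \<comment> \<open>Comparison with the constant solution at \<open>x t\<close>, backward from
      time \<open>t\<close> to 0.\<close>
    then have "x 0 = x t"
      using that
      by (intro lipschitz_ode_unique[OF lip, of 0 t x "\<lambda>_. x t" t 0])
         (auto intro: cont' der)
    with \<open>F (x t) = 0\<close> pos show False by simp
  qed
  have Fpos: "F (x t) > 0" if "t \<ge> 0" for t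
  proof (rule ccontr)
    assume "\<not> F (x t) > 0"
    then have "\<exists>s\<ge>0. s \<le> t \<and> F (x s) = 0"
      using that pos
      by (intro IVT2' continuous_on_compose2[OF contF[of UNIV] cont']) auto
    with nz show False by blast
  qed
  have mono: "x s \<le> x t" if "0 \<le> s" "s \<le> t" for s t
  proof (rule DERIV_nonneg_imp_increasing_open[OF that(2)])
    fix r assume "s < r" "r < t"
    with that der[of r] Fpos[of r]
    show "\<exists>d. (x has_real_derivative d) (at r) \<and> d \<ge> 0" by (auto intro: less_imp_le)
  qed (use cont' that in auto)
  \<comment> \<open>The bound \<open>b\<close> may fail to be an equilibrium; a zero
    \<open>c\<close> of \<open>F\<close> below it serves as a barrier.\<close>
  obtain c where c: "x 0 \<le> c" "c \<le> b" "F c = 0"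
    using IVT2'[of F b 0 "x 0"] contF pos b by auto
  have le: "x t \<le> c" if "t \<ge> 0" for t
  proof (rule ccontr)
    assume "\<not> x t \<le> c"
    then obtain s where "0 \<le> s" "x s = c"
      using IVT'[of x 0 c t] cont'[of 0 t] c \<open>t \<ge> 0\<close> by auto
    with nz c show False by auto
  qed
  have bdd: "bdd_above (x ` {0..})"
    using le by (intro bdd_aboveI[of _ c]) auto
  define l where "l = Sup (x ` {0..})"
  have xl: "x t \<le> l" if "t \<ge> 0" for t
    unfolding l_def using that bdd by (intro cSup_upper) auto
  have "l \<le> c"
    unfolding l_def using le by (intro cSup_least) auto
  have lim: "(x \<longlongrightarrow> l) at_top"
  proof (rule increasing_tendsto)
    show "\<forall>\<^sub>F t in at_top. x t \<le> l"
      using eventually_ge_at_top[of 0] by eventually_elim (rule xl)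
    fix u assume "u < l"
    then obtain s where s: "s \<ge> 0" "u < x s"
      unfolding l_def using less_cSup_iff[OF _ bdd] by auto
    show "\<forall>\<^sub>F t in at_top. u < x t"
      using eventually_ge_at_top[of s] by eventually_elim (use s mono in force)
  qed
  have limF: "((\<lambda>t. F (x t)) \<longlongrightarrow> F l) at_top"
    using contF[of UNIV] lim
    by (auto intro: isCont_tendsto_compose simp: continuous_on_eq_continuous_at)
  have "F l \<ge> 0"
    by (rule tendsto_lowerbound[OF limF])
       (auto intro: eventually_mono[OF eventually_ge_at_top[of 0]] less_imp_le Fpos)
  moreover have "\<not> F l > 0"
  proof
    assume "F l > 0"
    define m where "m = F l / 2"
    have "m > 0" "m < F l" using \<open>F l > 0\<close> by (auto simp: m_def)
    then have "\<forall>\<^sub>F t in at_top. m < F (x t)"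
      using order_tendstoD(1)[OF limF] by blast
    then obtain s0 where s0: "\<And>t. t \<ge> s0 \<Longrightarrow> m < F (x t)"
      unfolding eventually_at_top_linorder by blast
    define s where "s = max 0 s0"
    \<comment> \<open>From time \<open>s\<close> on the speed exceeds \<open>m\<close>; by this
      \<open>t\<close> the trajectory has reached at least \<open>l + m\<close>.\<close>
    define t where "t = s + ((l - x s) / m + 1)"
    have s: "s \<ge> 0" by (simp add: s_def)
    then have "(l - x s) / m \<ge> 0" using xl[of s] \<open>m > 0\<close> by simp
    then have "s < t" by (simp add: t_def)
    have "x s - m * s \<le> x t - m * t"
    proof (rule DERIV_nonneg_imp_increasing_open[OF less_imp_le[OF \<open>s < t\<close>]])
      fix r assume r: "s < r" "r < t"
      then have "((\<lambda>r. x r - m * r) has_real_derivative F (x r) - m) (at r)"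
        using s der[of r] by (auto intro!: derivative_eq_intros)
      moreover have "F (x r) - m \<ge> 0"
        using s0[of r] r by (simp add: s_def)
      ultimately show "\<exists>d. ((\<lambda>r. x r - m * r) has_real_derivative d) (at r) \<and> d \<ge> 0" by blast
    qed (use s in \<open>auto intro!: continuous_intros cont'\<close>)
    then have "x s + m * (t - s) \<le> x t" by (simp add: algebra_simps)
    moreover have "m * (t - s) = l - x s + m"
      using \<open>m > 0\<close> by (simp add: t_def field_simps)
    ultimately show False
      using xl[of t] s \<open>s < t\<close> \<open>m > 0\<close> by simp
  qed
  ultimately have "F l = 0" by simp
  with lim xl[of 0] \<open>l \<le> c\<close> c show ?thesis by auto
qed

text \<open>The sign of the initial speed decides: the trajectory is constant, increasing, or the
  reflection of an increasing one.\<close>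

lemma lipschitz_ode_limit:
  fixes F x :: "real \<Rightarrow> real"
  assumes lip: "L-lipschitz_on UNIV F"
    and cont: "continuous_on {0..} x"
    and der: "\<And>t. t > 0 \<Longrightarrow> (x has_real_derivative F (x t)) (at t)"
    and ab: "x 0 \<in> {a..b}" "F a \<ge> 0" "F b \<le> 0"
  shows "\<exists>l\<in>{a..b}. F l = 0 \<and> (x \<longlongrightarrow> l) at_top"
proof -
  consider "F (x 0) = 0" | "F (x 0) > 0" | "F (x 0) < 0" by linarith
  then show ?thesis
  proof cases
    case 1
    have "x t = x 0" if "t \<ge> 0" for t
      using that 1
      by (intro lipschitz_ode_unique[OF lip, of 0 t x "\<lambda>_. x 0" 0 t])
         (auto intro: der continuous_on_subset[OF cont])
    then have "(x \<longlongrightarrow> x 0) at_top"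
      by (intro tendsto_eventually eventually_mono[OF eventually_ge_at_top[of 0]])
    with 1 ab show ?thesis by blast
  next
    case 2
    with lipschitz_ode_limit_increasing[OF lip cont der, of b] ab show ?thesis by force
  next
    case 3
    \<comment> \<open>The curve \<open>- x\<close> solves the equation with field
      \<open>- F (- u)\<close>, which is positive at its start; the barrier \<open>a\<close> becomes
      \<open>- a\<close>.\<close>
    have "\<exists>l\<in>{- x 0..- a}. - F (- l) = 0 \<and> ((\<lambda>t. - x t) \<longlongrightarrow> l) at_top"
    proof (rule lipschitz_ode_limit_increasing)
      show "L-lipschitz_on UNIV (\<lambda>u. - F (- u))"
      proof (rule lipschitz_onI[OF _ lipschitz_on_nonneg[OF lip]])
        fix u v :: real
        show "dist (- F (- u)) (- F (- v)) \<le> L * dist u v"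
          using lipschitz_onD[OF lip, of "- u" "- v"] by (simp add: dist_minus)
      qed
    qed (use 3 ab cont der in \<open>auto intro!: continuous_intros derivative_eq_intros\<close>)
    then obtain l where l: "l \<in> {- x 0..- a}" "F (- l) = 0" "((\<lambda>t. - x t) \<longlongrightarrow> l) at_top"
      by auto
    from tendsto_minus[OF l(3)] have "(x \<longlongrightarrow> - l) at_top" by simp
    with l ab show ?thesis by (intro bexI[of _ "- l"]) auto
  qed
qed

section \<open>The projected dynamics\<close>

lemma convex_closed_nonempty_C: "convex C" "closed C" "C \<noteq> {}"
  by (auto simp: C_def)

text \<open>Projection onto a closed convex set is nonexpansive, and the map inside it is affine
  with slope \<open>1 - \<alpha> / \<rho>\<close>.\<close>

lemma lipschitz_projected_field:
  assumes "\<eta> > 0"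
  shows "\<exists>L. L-lipschitz_on UNIV (\<lambda>u. (1 / \<eta>) * (P_C (u - (1 / \<rho>) * (\<alpha> * u + \<beta>)) - u))"
proof -
  have P: "1-lipschitz_on UNIV P_C"
    using closest_point_lipschitz[OF convex_closed_nonempty_C] by (auto simp: lipschitz_on_def P_C_def)
  have A: "\<bar>1 - \<alpha> / \<rho>\<bar>-lipschitz_on UNIV (\<lambda>u. u - (1 / \<rho>) * (\<alpha> * u + \<beta>))"
  proof (rule lipschitz_onI)
    fix u v
    have "u - (1 / \<rho>) * (\<alpha> * u + \<beta>) - (v - (1 / \<rho>) * (\<alpha> * v + \<beta>)) = (1 - \<alpha> / \<rho>) * (u - v)"
      by (simp add: algebra_simps flip: add_divide_distrib)
    then show "dist (u - (1 / \<rho>) * (\<alpha> * u + \<beta>)) (v - (1 / \<rho>) * (\<alpha> * v + \<beta>))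
        \<le> \<bar>1 - \<alpha> / \<rho>\<bar> * dist u v"
      by (simp add: dist_real_def abs_mult)
  qed auto
  have "(1 * \<bar>1 - \<alpha> / \<rho>\<bar>)-lipschitz_on UNIV (\<lambda>u. P_C (u - (1 / \<rho>) * (\<alpha> * u + \<beta>)))"
    by (rule lipschitz_on_compose2[OF A lipschitz_on_subset[OF P]]) auto
  from lipschitz_on_cmult_real[OF lipschitz_on_diff[OF this lipschitz_on_id], of "1 / \<eta>"]
  show ?thesis by (rule exI)
qed

text \<open>The variational inequality of the projection, applied to a gradient step that projects
  back to \<open>u\<close>, is the KKT inequality scaled by \<open>1 / \<rho>\<close>.\<close>

lemma is_KKT_point_if_fixed:
  assumes "\<rho> > 0" and fixed: "P_C (u - (1 / \<rho>) * (\<alpha> * u + \<beta>)) = u"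
  shows "is_KKT_point \<alpha> \<beta> u"
  unfolding is_KKT_point_def
proof (intro conjI ballI)
  show "u \<in> C"
    using fixed closest_point_in_set[OF convex_closed_nonempty_C(2,3)] unfolding P_C_def by metis
  fix y assume "y \<in> C"
  have "(- (1 / \<rho>) * (\<alpha> * u + \<beta>)) * (y - u) \<le> 0"
    using closest_point_dot[OF convex_closed_nonempty_C(1,2) \<open>y \<in> C\<close>, of "u - (1 / \<rho>) * (\<alpha> * u + \<beta>)"] fixed
    by (simp add: P_C_def)
  then have "(1 / \<rho>) * ((\<alpha> * u + \<beta>) * (y - u)) \<ge> 0" by simp
  with assms(1) show "(\<alpha> * u + \<beta>) * (y - u) \<ge> 0"
    by (simp add: zero_le_divide_iff)
qed

lemma is_solution_continuous_on:
  assumes "is_solution \<eta> \<rho> \<alpha> \<beta> x0 x"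
  shows "continuous_on {0..} x"
  using assms unfolding is_solution_def C1_on_nonneg_def
  by (auto intro: DERIV_continuous_on)

theorem theorem4p1:
  fixes \<eta> \<rho> \<alpha> \<beta> x0 :: real
  assumes "\<eta> > 0" and "\<rho> > 0"
    and "x0 \<in> {-1..1}"
    and "\<alpha> \<le> 0 \<or> (\<alpha> > 0 \<and> \<rho> \<ge> \<alpha>)"
  shows "\<exists>x. is_solution \<eta> \<rho> \<alpha> \<beta> x0 x \<and>
             (\<forall>y. is_solution \<eta> \<rho> \<alpha> \<beta> x0 y \<longrightarrow> (\<forall>t\<ge>0. y t = x t)) \<and>
             (\<exists>xbar. is_KKT_point \<alpha> \<beta> xbar \<and> (x \<longlongrightarrow> xbar) at_top)"
proof -
  define F where "F u = (1 / \<eta>) * (P_C (u - (1 / \<rho>) * (\<alpha> * u + \<beta>)) - u)" for u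
  obtain L where lip: "L-lipschitz_on UNIV F"
    using lipschitz_projected_field[OF assms(1), of \<rho> \<alpha> \<beta>] unfolding F_def by blast
  have sol: "is_solution \<eta> \<rho> \<alpha> \<beta> x0 y \<longleftrightarrow> C1_on_nonneg y \<and>
      (\<forall>t>0. (y has_real_derivative F (y t)) (at t)) \<and> y 0 = x0" for y
    by (simp add: is_solution_def F_def)
  obtain x where x0: "x 0 = x0"
    and x: "\<And>t. t \<ge> 0 \<Longrightarrow> (x has_real_derivative F (x t)) (at t within {0..})"
    using lipschitz_ode_exists[OF lip, of x0] by blast
  have cont: "continuous_on {0..} x"
    by (rule DERIV_continuous_on) (use x in auto)
  have der: "(x has_real_derivative F (x t)) (at t)" if "t > 0" for t
    using x[of t] that at_within_interior[of t "{0..}"] by simp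
  \<comment> \<open>This composition is the continuous derivative demanded by
    \<open>C1_on_nonneg\<close>.\<close>
  have "continuous_on {0..} (\<lambda>t. F (x t))"
    by (rule continuous_on_compose2[OF lipschitz_on_continuous_on[OF lip] cont]) simp
  then have solx: "is_solution \<eta> \<rho> \<alpha> \<beta> x0 x"
    unfolding sol C1_on_nonneg_def using x x0 der by blast
  have "y t = x t" if y: "is_solution \<eta> \<rho> \<alpha> \<beta> x0 y" and "t \<ge> 0" for y t
  proof (rule lipschitz_ode_unique[OF lip, of 0 t y x 0])
    show "continuous_on {0..t} y" "continuous_on {0..t} x"
      using is_solution_continuous_on[OF y] cont by (auto intro: continuous_on_subset)
  qed (use y x0 der \<open>t \<ge> 0\<close> in \<open>auto simp: sol\<close>)
  moreover have "\<exists>l\<in>{-1..1}. F l = 0 \<and> (x \<longlongrightarrow> l) at_top"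
  proof (rule lipschitz_ode_limit[OF lip cont der])
    \<comment> \<open>Projected values stay in \<open>C\<close>, so the field does not point outward
      at either endpoint.\<close>
    have P: "- 1 \<le> P_C u \<and> P_C u \<le> 1" for u
      using closest_point_in_set[OF convex_closed_nonempty_C(2,3), of u] unfolding P_C_def by (simp add: C_def)
    show "F (- 1) \<ge> 0"
      unfolding F_def using assms(1) P[of "- 1 - (1 / \<rho>) * (\<alpha> * (- 1) + \<beta>)"]
      by (intro mult_nonneg_nonneg) auto
    show "F 1 \<le> 0"
      unfolding F_def using assms(1) P by (intro mult_nonneg_nonpos) auto
  qed (use assms x0 in auto)
  then obtain l where "F l = 0" "(x \<longlongrightarrow> l) at_top" by blast
  moreover have "is_KKT_point \<alpha> \<beta> l"
    using \<open>F l = 0\<close> assms(1) by (intro is_KKT_point_if_fixed[OF assms(2)]) (simp add: F_def)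
  ultimately show ?thesis using solx by blast
qed

end
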